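(* Every instance $(N,A,V)$ of Fair Division with Externalities with three agents ($|N|=3$), binary valuations ($V_i(j,a)\in\{0,1\}$ for all $i,j\in N$, $a\in A$), and no weak-chores (no item is a weak-chore for any agent) admits an EFX allocation, and such an allocation can be computed in polynomial time.
   Context: An instance $(N,A,V)$ of Fair Division with Externalities consists of a set of agents $N=\{1,\dots,n\}$, a set of indivisible items $A=\{a_1,\dots,a_m\}$, and for all agents $i,j\in N$ and every item $a\in A$ a number $V_i(j,a)$: the value agent $i$ gets if item $a$ is allocated to agent $j$ (here $j=i$ is allowed). An allocation of a set of items is a partition $\pi=(\pi_1,\dots,\pi_n)$ of that set into $n$ possibly empty bundles, $\pi_i$ being given to agent $i$; $\pi(a)$ denotes the agent receiving $a$. The value of $\pi$ for agent $i$ is $V_i(\pi)=\sum_a V_i(\pi(a),a)$, the sum ranging over the items allocated by $\pi$. $\pi^{i\leftrightarrow j}$ denotes the allocation obtained from $\pi$ by swapping the bundles of agents $i$ and $j$ and leaving the other bundles unchanged. EFX: an allocation $\pi$ of $A$ is envy-free up to any item (EFX) if for every pair of agents $i,j\in N$ with $V_i(\pi)<V_i(\pi^{i\leftrightarrow j})$ the following holds: for any item $a\in A$ and the allocation $\lambda$ (of $A\setminus\{a\}$) with $\lambda_\ell=\pi_\ell\setminus\{a\}$ for all $\ell\in N$, if $V_i(\lambda)-V_i(\lambda^{i\leftrightarrow j})>V_i(\pi)-V_i(\pi^{i\leftrightarrow j})$, then $V_i(\lambda)\ge V_i(\lambda^{i\leftrightarrow j})$. An item $a$ is a weak-chore for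 agent $i$ if there exists an agent $j$ such that $V_i(i,a)<V_i(j,a)$. *)

theory Defs
  imports Complex_Main "HOL-Library.Disjoint_Sets" "HOL-Computational_Algebra.Polynomial"
begin

text \<open>Agents are the numbers \<open>1, \<dots>, n\<close>; \<open>V i j a\<close> is the value agent \<open>i\<close> gets if item \<open>a\<close> goes
  to agent \<open>j\<close>; an allocation is given by its bundles, \<open>\<pi> i\<close> being the bundle of agent \<open>i\<close>.
  Only arguments in \<open>{1..n}\<close> matter.\<close>

type_synonym 'a valuation = "nat \<Rightarrow> nat \<Rightarrow> 'a \<Rightarrow> real"
type_synonym 'a alloc = "nat \<Rightarrow> 'a set"

definition is_allocation :: "nat \<Rightarrow> 'a set \<Rightarrow> 'a alloc \<Rightarrow> bool" where
  "is_allocation n A \<pi> \<longleftrightarrow> disjoint_family_on \<pi> {1..n} \<and> (\<Union>i\<in>{1..n}. \<pi> i) = A"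

definition receiver :: "nat \<Rightarrow> 'a alloc \<Rightarrow> 'a \<Rightarrow> nat" where
  "receiver n \<pi> a = (THE i. i \<in> {1..n} \<and> a \<in> \<pi> i)"

definition alloc_value :: "nat \<Rightarrow> 'a valuation \<Rightarrow> nat \<Rightarrow> 'a alloc \<Rightarrow> real" where
  "alloc_value n V i \<pi> = (\<Sum>a\<in>(\<Union>j\<in>{1..n}. \<pi> j). V i (receiver n \<pi> a) a)"

definition swap_bundles :: "nat \<Rightarrow> nat \<Rightarrow> 'a alloc \<Rightarrow> 'a alloc" where
  "swap_bundles i j \<pi> = \<pi>(i := \<pi> j, j := \<pi> i)"

definition remove_item :: "'a \<Rightarrow> 'a alloc \<Rightarrow> 'a alloc" where
  "remove_item a \<pi> = (\<lambda>l. \<pi> l - {a})"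

definition EFX :: "nat \<Rightarrow> 'a set \<Rightarrow> 'a valuation \<Rightarrow> 'a alloc \<Rightarrow> bool" where
  "EFX n A V \<pi> \<longleftrightarrow> is_allocation n A \<pi> \<and>
     (\<forall>i\<in>{1..n}. \<forall>j\<in>{1..n}.
        alloc_value n V i \<pi> < alloc_value n V i (swap_bundles i j \<pi>) \<longrightarrow>
        (\<forall>a\<in>A. let \<rho> = remove_item a \<pi> in
           alloc_value n V i \<rho> - alloc_value n V i (swap_bundles i j \<rho>)
             > alloc_value n V i \<pi> - alloc_value n V i (swap_bundles i j \<pi>) \<longrightarrow>
           alloc_value n V i \<rho> \<ge> alloc_value n V i (swap_bundles i j \<rho>)))"

definition weak_chore :: "nat \<Rightarrow> 'a valuation \<Rightarrow> nat \<Rightarrow> 'a \<Rightarrow> bool" where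
  "weak_chore n V i a \<longleftrightarrow> (\<exists>j\<in>{1..n}. V i i a < V i j a)"

definition no_weak_chores :: "nat \<Rightarrow> 'a set \<Rightarrow> 'a valuation \<Rightarrow> bool" where
  "no_weak_chores n A V \<longleftrightarrow> (\<forall>i\<in>{1..n}. \<forall>a\<in>A. \<not> weak_chore n V i a)"

definition binary_valuations :: "nat \<Rightarrow> 'a set \<Rightarrow> 'a valuation \<Rightarrow> bool" where
  "binary_valuations n A V \<longleftrightarrow> (\<forall>i\<in>{1..n}. \<forall>j\<in>{1..n}. \<forall>a\<in>A. V i j a \<in> {0, 1})"

text \<open>The model of computation is the language WHILE of N. D. Jones (Computability and Complexity
  from a Programming Perspective, MIT Press 1997) with its unit-cost time measure. The data are
  binary trees, and the only test is whether a tree is a leaf. With trees stored as shared pointer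
  structures, each elementary operation takes constantly many pointer manipulations and creates at
  most one new cell (also \<open>x := Node_E x x\<close>, which does not copy), so polynomial time here is
  polynomial time on Turing machines. There is deliberately no unit-cost equality test on trees.\<close>

datatype tree = Leaf | Node tree tree

fun left :: "tree \<Rightarrow> tree" where
  "left Leaf = Leaf"
| "left (Node l r) = l"

fun right :: "tree \<Rightarrow> tree" where
  "right Leaf = Leaf"
| "right (Node l r) = r"

fun tree_size :: "tree \<Rightarrow> nat" where
  "tree_size Leaf = 1"
| "tree_size (Node l r) = 1 + tree_size l + tree_size r"

datatype expr = Var nat | Leaf_E | Node_E expr expr | Left_E expr | Right_E expr

datatype com =
    Skip
  | Assign nat expr
  | Seq com com
  | Cond expr com com
  | While expr com

type_synonym store = "nat \<Rightarrow> tree"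

fun eval_expr :: "expr \<Rightarrow> store \<Rightarrow> tree" where
  "eval_expr (Var x) s = s x"
| "eval_expr Leaf_E s = Leaf"
| "eval_expr (Node_E e f) s = Node (eval_expr e s) (eval_expr f s)"
| "eval_expr (Left_E e) s = left (eval_expr e s)"
| "eval_expr (Right_E e) s = right (eval_expr e s)"

fun expr_time :: "expr \<Rightarrow> nat" where
  "expr_time (Var x) = 1"
| "expr_time Leaf_E = 1"
| "expr_time (Node_E e f) = 1 + expr_time e + expr_time f"
| "expr_time (Left_E e) = 1 + expr_time e"
| "expr_time (Right_E e) = 1 + expr_time e"

text \<open>\<open>exec c s t s'\<close>: started in store \<open>s\<close>, the command \<open>c\<close> halts after time \<open>t\<close> in store \<open>s'\<close>.
  A leaf counts as false, every other tree as true.\<close>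

inductive exec :: "com \<Rightarrow> store \<Rightarrow> nat \<Rightarrow> store \<Rightarrow> bool" where
  exec_Skip: "exec Skip s 1 s"
| exec_Assign: "exec (Assign x e) s (1 + expr_time e) (s(x := eval_expr e s))"
| exec_Seq: "exec c s t s' \<Longrightarrow> exec d s' u s'' \<Longrightarrow> exec (Seq c d) s (t + u) s''"
| exec_CondTrue: "eval_expr e s \<noteq> Leaf \<Longrightarrow> exec c s t s'
    \<Longrightarrow> exec (Cond e c d) s (1 + expr_time e + t) s'"
| exec_CondFalse: "eval_expr e s = Leaf \<Longrightarrow> exec d s t s'
    \<Longrightarrow> exec (Cond e c d) s (1 + expr_time e + t) s'"
| exec_WhileFalse: "eval_expr e s = Leaf \<Longrightarrow> exec (While e c) s (1 + expr_time e) s"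
| exec_WhileTrue: "eval_expr e s \<noteq> Leaf \<Longrightarrow> exec c s t s' \<Longrightarrow> exec (While e c) s' u s''
    \<Longrightarrow> exec (While e c) s (1 + expr_time e + t + u) s''"

inductive_cases exec_SkipE: "exec Skip s t s'"
inductive_cases exec_AssignE: "exec (Assign x e) s t s'"
inductive_cases exec_SeqE: "exec (Seq c d) s t s'"
inductive_cases exec_CondE: "exec (Cond e c d) s t s'"
inductive_cases exec_WhileE: "exec (While e c) s t s'"

lemma exec_deterministic:
  "exec c s t s' \<Longrightarrow> exec c s u s'' \<Longrightarrow> u = t \<and> s'' = s'"
proof (induction arbitrary: u s'' rule: exec.induct)
  case exec_Skip then show ?case by (elim exec_SkipE) simp
next
  case exec_Assign then show ?case by (elim exec_AssignE) simp
next
  case exec_Seq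
  from exec_Seq.prems show ?case by (rule exec_SeqE) (auto dest!: exec_Seq.IH)
next
  case exec_CondTrue
  from exec_CondTrue.prems show ?case
    by (rule exec_CondE) (auto simp: exec_CondTrue.hyps(1) dest!: exec_CondTrue.IH)+
next
  case exec_CondFalse
  from exec_CondFalse.prems show ?case
    by (rule exec_CondE) (auto simp: exec_CondFalse.hyps(1) dest!: exec_CondFalse.IH)+
next
  case exec_WhileFalse
  from exec_WhileFalse.prems show ?case
    by (rule exec_WhileE) (auto simp: exec_WhileFalse.hyps)+
next
  case exec_WhileTrue
  from exec_WhileTrue.prems show ?case
    by (rule exec_WhileE) (auto simp: exec_WhileTrue.hyps(1) dest!: exec_WhileTrue.IH)+
qed

text \<open>Input and output are held by variable \<open>0\<close>; all other variables start as leaves.\<close>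

definition computes_in :: "com \<Rightarrow> tree \<Rightarrow> tree \<Rightarrow> nat \<Rightarrow> bool" where
  "computes_in c d e t \<longleftrightarrow> (\<exists>s. exec c ((\<lambda>_. Leaf)(0 := d)) t s \<and> s 0 = e)"

fun enc_list :: "tree list \<Rightarrow> tree" where
  "enc_list [] = Leaf"
| "enc_list (d # ds) = Node d (enc_list ds)"

definition enc_nat :: "nat \<Rightarrow> tree" where
  "enc_nat k = enc_list (replicate k Leaf)"

definition enc_bit :: "real \<Rightarrow> tree" where
  "enc_bit v = (if v = 0 then Leaf else Node Leaf Leaf)"

text \<open>An instance with items \<open>1, \<dots>, m\<close> and binary valuations is given as the list, over all items,
  of the 0/1 matrices of the values \<open>V i j a\<close>; an allocation as the list of the receivers.\<close>

definition enc_instance :: "nat \<Rightarrow> nat \<Rightarrow> nat valuation \<Rightarrow> tree" where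
  "enc_instance n m V =
     enc_list (map (\<lambda>a. enc_list (map (\<lambda>i. enc_list (map (\<lambda>j. enc_bit (V i j a))
       [1..<Suc n])) [1..<Suc n])) [1..<Suc m])"

definition enc_allocation :: "nat \<Rightarrow> nat \<Rightarrow> nat alloc \<Rightarrow> tree" where
  "enc_allocation n m \<pi> = enc_list (map (\<lambda>a. enc_nat (receiver n \<pi> a)) [1..<Suc m])"

end

theory Submission
  imports Defs
begin

text \<open>
  Without weak-chores and with binary values, \<open>V i i a - V i j a\<close> is 0 or 1. Let \<open>D i j\<close> be the set of
  items where it is 1. Then \<open>\<pi>\<close> is EFX as soon as
  \<open>|\<pi> i \<inter> D i j| - |\<pi> j \<inter> D i j| \<ge> - 1\<close> for all agents \<open>i \<noteq> j\<close>, and the six sets \<open>D i j\<close> are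
  arbitrary, so there are 64 types of items. If a nonempty set of items can be assigned with all six
  differences nonnegative, then it can be split off by induction. An exhaustive search shows
  that sets without such a subset have at most five items, and that each of them has an assignment
  with all differences at least \<open>- 1\<close>.

  For the algorithm, three items of the same type contribute 0 when every agent gets one of them. Hence
  only the numbers of items of each type modulo 3 matter: one pass over the input determines them, a
  finite table gives the receivers of the remaining items, and a second pass writes the allocation.
\<close>

section \<open>Exhaustive search\<close>

datatype step = Down | Stay | Up

text \<open>
  A gain is a vector with one coordinate per ordered pair of distinct agents, in the order
  (1,2), (1,3), (2,1), (2,3), (3,1), (3,2). An item type lists, for each of the three possible
  receivers, the change of every coordinate. Only vectors with all coordinates at least \<open>- 1\<close> are
  kept during the search; the number \<open>s\<close> stands for the coordinate \<open>s - 1\<close>. All tests are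
  passed on as Boolean arguments instead of using \<open>if\<close> and \<open>let\<close>, so that rewriting evaluates
  the functions strictly.
\<close>

fun cancels :: "nat list \<Rightarrow> step list \<Rightarrow> bool" where
  "cancels (s # us) (Up # vs) = cancels us vs"
| "cancels (Suc s # us) (Stay # vs) = cancels us vs"
| "cancels (Suc (Suc s) # us) (Down # vs) = cancels us vs"
| "cancels [] [] = True"
| "cancels _ _ = False"

text \<open>Only lowering a coordinate coded \<open>0\<close> would produce a value below
  -1.\<close>

fun fits :: "nat list \<Rightarrow> step list \<Rightarrow> bool" where
  "fits (0 # us) (Down # vs) = False"
| "fits (s # us) (v # vs) = fits us vs"
| "fits us vs = True"

fun move :: "nat list \<Rightarrow> step list \<Rightarrow> nat list" where
  "move (s # us) (Up # vs) = Suc s # move us vs"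
| "move (s # us) (Stay # vs) = s # move us vs"
| "move (Suc s # us) (Down # vs) = s # move us vs"
| "move us vs = []"

fun cons_unless :: "bool \<Rightarrow> 'a \<Rightarrow> 'a list \<Rightarrow> 'a list" where
  "cons_unless True x xs = xs"
| "cons_unless False x xs = x # xs"

fun cons_move :: "bool \<Rightarrow> nat list \<Rightarrow> step list \<Rightarrow> nat list list \<Rightarrow> nat list list" where
  "cons_move True u v us = move u v # us"
| "cons_move False u v us = us"

fun moves :: "nat list \<Rightarrow> step list list \<Rightarrow> nat list list \<Rightarrow> nat list list" where
  "moves u [] us = us"
| "moves u (v # vs) us = cons_move (fits u v) u v (moves u vs us)"

fun add_opts :: "nat list list \<Rightarrow> step list list \<Rightarrow> nat list list" where
  "add_opts [] ty = []"
| "add_opts (u # us) ty = moves u ty (add_opts us ty)"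

fun any_cancels :: "bool \<Rightarrow> nat list list \<Rightarrow> step list \<Rightarrow> bool" where
  "any_cancels True us v = True"
| "any_cancels False [] v = False"
| "any_cancels False (u # us) v = any_cancels (cancels u v) us v"

fun reducible :: "bool \<Rightarrow> nat list list \<Rightarrow> step list list \<Rightarrow> bool" where
  "reducible True us vs = True"
| "reducible False us [] = False"
| "reducible False us (v # vs) = reducible (any_cancels False us v) us vs"

fun prune :: "nat list list \<Rightarrow> step list list list \<Rightarrow> step list list list" where
  "prune N [] = []"
| "prune N (ty # ts) = cons_unless (reducible False N ty) ty (prune N ts)"

fun both :: "bool \<Rightarrow> bool \<Rightarrow> bool" where
  "both True b = b"
| "both False b = False"

text \<open>
  In a node of the search some items have been picked: \<open>F\<close> contains gains of assignments of all of
  them, \<open>P\<close> gains of assignments of some of them, and \<open>ts\<close> the types of which further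
  items can still exist if no nonempty set of items has an assignment of gain \<open>\<ge> 0\<close>. The depth 6
  suffices because no set of more than five items has this property.
\<close>

function (sequential) explore :: "nat \<Rightarrow> step list list list \<Rightarrow> nat list list \<Rightarrow> nat list list \<Rightarrow> bool"
and branch :: "nat \<Rightarrow> step list list list \<Rightarrow> nat list list \<Rightarrow> nat list list \<Rightarrow> bool"
and extend :: "nat \<Rightarrow> step list list \<Rightarrow> step list list list \<Rightarrow> nat list list \<Rightarrow> nat list list \<Rightarrow> nat list list \<Rightarrow> bool" where
  "explore 0 ts P F = False"
| "explore (Suc n) ts P [] = False"
| "explore (Suc n) ts P (f # F) = branch n ts P (f # F)"
| "branch n [] P F = True"
| "branch n (ty # ts) P F = both (extend n ty ts P F (add_opts P ty)) (branch n ts P F)"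
| "extend n ty ts P F N = explore n (prune N (ty # ts)) (P @ N) (add_opts F ty)"
  by pat_completeness auto

termination
  \<comment> \<open>\<open>explore\<close> counts 0 in the second component, so that
    \<open>extend\<close> may call it at the same depth.\<close>
  by (relation "inv_image (less_than <*lex*> less_than)
      (case_sum (\<lambda>(n, ts, P, F). (n, 0))
        (case_sum (\<lambda>(n, ts, P, F). (n, length ts + 1)) (\<lambda>(n, ty, ts, P, F, N). (n, length ts + 1))))")
    auto

definition pos :: "bool \<Rightarrow> step" where "pos b = (if b then Up else Stay)"
definition neg :: "bool \<Rightarrow> step" where "neg b = (if b then Down else Stay)"

text \<open>The argument tells which of the agents \<open>i\<close> care whether \<open>j\<close> gets the item instead of \<open>i\<close>.\<close>

fun opts :: "bool list \<Rightarrow> step list list" where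
  "opts [a, b, c, d, e, f] = [[pos a, pos b, neg c, Stay, neg e, Stay],
     [neg a, Stay, pos c, pos d, Stay, neg f], [Stay, neg b, Stay, neg d, pos e, pos f]]"
| "opts _ = []"

definition start :: "nat list" where "start = [1, 1, 1, 1, 1, 1]"

text \<open>\<open>start\<close> codes the zero vector, the gain of the empty set. Pruning with it
  drops the types of which one item alone can be assigned with gain at least 0.\<close>

definition all_types :: "step list list list" where
  "all_types = prune [start] (map opts (List.n_lists 6 [False, True]))"

text \<open>The whole case analysis is this one evaluation. Every picked item lowers the depth by
  one, so depth 0, where the search fails, would be met only after six picks.\<close>

lemma explore_all_types: "explore 6 all_types [start] [start]"
  by code_simp

section \<open>Integer meaning of the coded vectors\<close>

fun step_val :: "step \<Rightarrow> int" where
  "step_val Down = - 1"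
| "step_val Stay = 0"
| "step_val Up = 1"

definition vadd :: "int list \<Rightarrow> int list \<Rightarrow> int list" where
  "vadd u v = map2 (+) u v"

definition vge :: "int \<Rightarrow> int list \<Rightarrow> bool" where
  "vge c u \<longleftrightarrow> (\<forall>x\<in>set u. c \<le> x)"

definition level :: "nat list \<Rightarrow> int list" where
  "level u = map (\<lambda>s. int s - 1) u"

definition vals :: "step list \<Rightarrow> int list" where
  "vals v = map step_val v"

lemma vge_level: "vge (- 1) (level u)"
  by (auto simp: vge_def level_def)

lemma vge_vadd: "vge c u \<Longrightarrow> vge d v \<Longrightarrow> vge (c + d) (vadd u v)"
  unfolding vge_def vadd_def by (auto dest!: set_zip_leftD set_zip_rightD intro: add_mono simp: set_zip)

lemma vge_if_cancels: "cancels u v \<Longrightarrow> vge 0 (vadd (level u) (vals v))"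
  by (induction u v rule: cancels.induct) (auto simp: vge_def vadd_def level_def vals_def)

text \<open>\<open>fits\<close> excludes a \<open>0\<close> meeting \<open>Down\<close>, where
  \<open>move\<close> breaks off because no natural number codes the result -2.\<close>

lemma level_move: "fits u v \<Longrightarrow> level (move u v) = vadd (level u) (vals v)"
  by (induction u v rule: move.induct) (auto simp: vadd_def level_def vals_def)

lemma in_set_moves:
  "w \<in> set (moves u ty us) \<Longrightarrow> w \<in> set us \<or> (\<exists>v\<in>set ty. level w = vadd (level u) (vals v))"
proof (induction ty)
  case (Cons v ty)
  then show ?case by (cases "fits u v") (auto simp: level_move)
qed simp

lemma in_set_add_opts:
  "w \<in> set (add_opts us ty) \<Longrightarrow> \<exists>u\<in>set us. \<exists>v\<in>set ty. level w = vadd (level u) (vals v)"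
  by (induction us) (auto dest!: in_set_moves)

text \<open>The flag carries a success found at an earlier vector, so the induction needs it in the
  conclusion.\<close>

lemma any_cancelsD:
  "any_cancels b us v \<Longrightarrow> b \<or> (\<exists>u\<in>set us. vge 0 (vadd (level u) (vals v)))"
  by (induction b us v rule: any_cancels.induct) (auto simp: vge_if_cancels)

lemma reducibleD:
  "reducible b us ty \<Longrightarrow> b \<or> (\<exists>u\<in>set us. \<exists>v\<in>set ty. vge 0 (vadd (level u) (vals v)))"
  by (induction b us ty rule: reducible.induct) (auto dest: any_cancelsD)

lemma set_prune: "set (prune N ts) = {ty \<in> set ts. \<not> reducible False N ty}"
proof (induction ts)
  case (Cons ty ts)
  then show ?case by (cases "reducible False N ty") auto
qed simp

lemma both_iff: "both a b \<longleftrightarrow> a \<and> b"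
  by (cases a) auto

section \<open>Gains attainable by assigning a set of items, and soundness of the search\<close>

definition gain_total :: "('a \<Rightarrow> step list list) \<Rightarrow> ('a \<Rightarrow> nat) \<Rightarrow> 'a set \<Rightarrow> int list" where
  "gain_total ty p S = map (\<lambda>c. \<Sum>a\<in>S. step_val (ty a ! p a ! c)) [0..<6]"

definition reach :: "('a \<Rightarrow> step list list) \<Rightarrow> 'a set \<Rightarrow> int list set" where
  "reach ty S = {gain_total ty p S |p. \<forall>a\<in>S. p a < length (ty a)}"

lemma reach_empty: "level start \<in> reach ty {}"
  by (auto simp: reach_def gain_total_def level_def start_def upt_rec)

lemma reach_singleton:
  assumes "v \<in> set (ty a)" "length v = 6"
  shows "vals v \<in> reach ty {a}"
proof -
  obtain k where k: "k < length (ty a)" "ty a ! k = v"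
    using assms(1) by (auto simp: in_set_conv_nth)
  have "gain_total ty (\<lambda>_. k) {a} = vals v"
    using k assms(2) by (auto simp: gain_total_def vals_def intro: nth_equalityI)
  then show ?thesis using k by (force simp: reach_def)
qed

text \<open>Gains are sums over items, so assignments of disjoint sets can be glued and their gains
  add.\<close>

lemma reach_union:
  assumes "u \<in> reach ty S" "v \<in> reach ty T" "S \<inter> T = {}" "finite S" "finite T"
  shows "vadd u v \<in> reach ty (S \<union> T)"
proof -
  obtain p q where p: "u = gain_total ty p S" "\<forall>a\<in>S. p a < length (ty a)"
    and q: "v = gain_total ty q T" "\<forall>a\<in>T. q a < length (ty a)"
    using assms(1,2) by (auto simp: reach_def)
  define r where "r a = (if a \<in> S then p a else q a)" for a
  have r: "\<And>a. a \<in> S \<Longrightarrow> r a = p a" "\<And>a. a \<in> T \<Longrightarrow> r a = q a"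
    using assms(3) by (auto simp: r_def)
  have "gain_total ty r (S \<union> T) = vadd u v"
    using assms(3-5) r
    by (auto simp: p(1) q(1) gain_total_def vadd_def sum.union_disjoint intro!: nth_equalityI)
  moreover have "\<forall>a\<in>S \<union> T. r a < length (ty a)"
    using p(2) q(2) r by auto
  ultimately show ?thesis unfolding reach_def by (intro CollectI exI[of _ r]) simp
qed

text \<open>Invariant of the search, with \<open>B\<close> the set of items picked so far. Once
  \<open>B\<close> is all of \<open>A\<close>, any vector of \<open>F\<close> is a suitable gain,
  because coded coordinates are at least -1.\<close>

lemma explore_sound:
  fixes ty :: "'a \<Rightarrow> step list list"
  assumes fin: "finite A"
    and len: "\<And>a v. a \<in> A \<Longrightarrow> v \<in> set (ty a) \<Longrightarrow> length v = 6"
    and irred: "\<And>S u. S \<subseteq> A \<Longrightarrow> S \<noteq> {} \<Longrightarrow> u \<in> reach ty S \<Longrightarrow> \<not> vge 0 u"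
  shows "\<lbrakk>explore n ts P F; B \<subseteq> A; \<And>u. u \<in> set P \<Longrightarrow> \<exists>S\<subseteq>B. level u \<in> reach ty S;
      \<And>u. u \<in> set F \<Longrightarrow> level u \<in> reach ty B; \<And>a. a \<in> A - B \<Longrightarrow> ty a \<in> set ts\<rbrakk>
      \<Longrightarrow> \<exists>u\<in>reach ty A. vge (- 1) u"
    and "\<lbrakk>branch n ts P F; B \<subset> A; \<And>u. u \<in> set P \<Longrightarrow> \<exists>S\<subseteq>B. level u \<in> reach ty S;
      \<And>u. u \<in> set F \<Longrightarrow> level u \<in> reach ty B; \<And>a. a \<in> A - B \<Longrightarrow> ty a \<in> set ts\<rbrakk>
      \<Longrightarrow> \<exists>u\<in>reach ty A. vge (- 1) u"
    and "\<lbrakk>extend n t ts P F N; N = add_opts P t; B \<subset> A; \<exists>a\<in>A - B. ty a = t;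
      \<And>u. u \<in> set P \<Longrightarrow> \<exists>S\<subseteq>B. level u \<in> reach ty S;
      \<And>u. u \<in> set F \<Longrightarrow> level u \<in> reach ty B; \<And>a. a \<in> A - B \<Longrightarrow> ty a \<in> set (t # ts)\<rbrakk>
      \<Longrightarrow> \<exists>u\<in>reach ty A. vge (- 1) u"
proof (induction n ts P F and n ts P F and n t ts P F N arbitrary: B and B and B
    rule: explore_branch_extend.induct)
  case (3 n ts P f F)
  show ?case
  proof (cases "B = A")
    case True
    then show ?thesis using "3.prems"(4)[of f] vge_level[of f] by auto
  next
    case False
    then have "B \<subset> A" using "3.prems"(2) by blast
    then show ?thesis using "3.IH" "3.prems" by simp
  qed
next
  case (5 n t ts P F)
  show ?case
  \<comment> \<open>The next pick has the first listed type that occurs outside \<open>B\<close>;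
    the types before it are dropped for good, so different orders of the same picks are not searched
    again.\<close>
  proof (cases "\<exists>a\<in>A - B. ty a = t")
    case True
    then show ?thesis using "5.prems"(1) by (intro "5.IH"(1)[OF _ refl "5.prems"(2) True "5.prems"(3-5)])
        (auto simp: both_iff)
  next
    case False
    then have "\<And>a. a \<in> A - B \<Longrightarrow> ty a \<in> set ts"
      using "5.prems"(5) by fastforce
    then show ?thesis using "5.prems"(1) by (intro "5.IH"(2)[OF _ "5.prems"(2-4)])
        (auto simp: both_iff)
  qed
next
  case (6 n t ts P F N)
  obtain a where a: "a \<in> A" "a \<notin> B" "ty a = t" using "6.prems"(4) by blast
  have add: "vadd u (vals v) \<in> reach ty (insert b S)"
    if "u \<in> reach ty S" "S \<subseteq> A" "b \<in> A - S" "v \<in> set (ty b)" for u v S b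
  proof -
    have "length v = 6" using len[of b v] that(3,4) by simp
    then have "vals v \<in> reach ty {b}" using reach_singleton[of v ty b] that(4) by simp
    then have "vadd u (vals v) \<in> reach ty (S \<union> {b})"
      using that fin by (intro reach_union) (auto intro: finite_subset)
    then show ?thesis by simp
  qed
  have N: "\<exists>S\<subseteq>B. level u \<in> reach ty (insert a S)" if u: "u \<in> set N" for u
  proof -
    obtain w v where "w \<in> set P" "v \<in> set t" "level u = vadd (level w) (vals v)"
      using u in_set_add_opts "6.prems"(2) by blast
    moreover then obtain S where "S \<subseteq> B" "level w \<in> reach ty S" using "6.prems"(5) by blast
    ultimately have "level u \<in> reach ty (insert a S)"
      using add[of "level w" S a v] a "6.prems"(3) by auto
    then show ?thesis using \<open>S \<subseteq> B\<close> by blast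
  qed
  show ?case
  proof (rule "6.IH"[of "insert a B"])
    show "explore n (prune N (t # ts)) (P @ N) (add_opts F t)" using "6.prems"(1) by simp
    show "insert a B \<subseteq> A" using a "6.prems"(3) by blast
  next
    fix u assume "u \<in> set (P @ N)"
    then show "\<exists>S\<subseteq>insert a B. level u \<in> reach ty S"
      using N[of u] "6.prems"(5)[of u] by (auto; meson insert_mono subset_insertI2)
  next
    fix u assume "u \<in> set (add_opts F t)"
    then obtain w v where "w \<in> set F" "v \<in> set t" "level u = vadd (level w) (vals v)"
      using in_set_add_opts by blast
    then show "level u \<in> reach ty (insert a B)"
      using add[of "level w" B a v] a "6.prems"(3,6) by auto
  next
    fix b assume b: "b \<in> A - insert a B"
    \<comment> \<open>If \<open>b\<close> could complete a gain in \<open>N\<close> to a nonnegative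
      one, then \<open>S\<close>, \<open>a\<close> and \<open>b\<close> would form a set excluded by
      \<open>irred\<close>.\<close>
    have "\<not> reducible False N (ty b)"
    proof
      assume "reducible False N (ty b)"
      then obtain u v where uv: "u \<in> set N" "v \<in> set (ty b)" "vge 0 (vadd (level u) (vals v))"
        using reducibleD by blast
      then obtain S where S: "S \<subseteq> B" "level u \<in> reach ty (insert a S)" using N by blast
      then have "vadd (level u) (vals v) \<in> reach ty (insert b (insert a S))"
        using a b uv(2) "6.prems"(3) by (intro add) auto
      then show False using irred[of "insert b (insert a S)"] uv(3) a b S(1) "6.prems"(3) by blast
    qed
    then show "ty b \<in> set (prune N (t # ts))" unfolding set_prune using b "6.prems"(7) by auto
  qed
\<comment> \<open>With no type left there is no item outside \<open>B\<close>, against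
  \<open>B \<subset> A\<close>; in the cases where the search fails, the premise is false.\<close>
qed (simp_all, blast)

text \<open>Strong induction: a nonempty \<open>S\<close> with a nonnegative gain is split off, and
  adding its gain preserves the bound -1 obtained for \<open>A - S\<close>. If there is no such
  \<open>S\<close>, the search applies from \<open>B = {}\<close>.\<close>

lemma balanced_choice_exists:
  assumes "finite A" and types: "\<And>a. a \<in> A \<Longrightarrow> ty a \<in> opts ` {ds. length ds = 6}"
  shows "\<exists>u\<in>reach ty A. vge (- 1) u"
  using assms
proof (induction rule: finite_psubset_induct)
  case (psubset A)
  have len: "length v = 6" if "a \<in> A" "v \<in> set (ty a)" for a v
    using psubset.prems[OF that(1)] that(2) by (auto simp: length_Suc_conv numeral_eq_Suc)
  show ?case
  proof (cases "\<exists>S u. S \<subseteq> A \<and> S \<noteq> {} \<and> u \<in> reach ty S \<and> vge 0 u")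
    case True
    then obtain S u where S: "S \<subseteq> A" "S \<noteq> {}" "u \<in> reach ty S" "vge 0 u" by blast
    obtain w where w: "w \<in> reach ty (A - S)" "vge (- 1) w"
      using psubset.IH[of "A - S"] psubset.prems S(1,2) by blast
    have "vadd u w \<in> reach ty (S \<union> (A - S))"
      using S w psubset.hyps by (intro reach_union) (auto intro: finite_subset)
    moreover have "S \<union> (A - S) = A" using S(1) by blast
    moreover have "vge (- 1) (vadd u w)" using vge_vadd[OF S(4) w(2)] by simp
    ultimately show ?thesis by auto
  next
    case False
    then have irred: "\<And>S u. S \<subseteq> A \<Longrightarrow> S \<noteq> {} \<Longrightarrow> u \<in> reach ty S \<Longrightarrow> \<not> vge 0 u" by blast
    have "ty a \<in> set all_types" if a: "a \<in> A" for a
    proof -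
      \<comment> \<open>Otherwise \<open>{a}\<close> itself would have a nonnegative gain.\<close>
      have "\<not> reducible False [start] (ty a)"
      proof
        assume "reducible False [start] (ty a)"
        then obtain v where v: "v \<in> set (ty a)" "vge 0 (vadd (level start) (vals v))"
          by (auto dest: reducibleD)
        have "vadd (level start) (vals v) \<in> reach ty ({} \<union> {a})"
          using reach_empty reach_singleton[of v] v(1) len[OF a] by (intro reach_union) auto
        then show False using irred[of "{a}"] a v(2) by simp
      qed
      then show ?thesis using psubset.prems[OF a] by (auto simp: all_types_def set_prune set_n_lists)
    qed
    then show ?thesis
      by (intro explore_sound(1)[OF psubset.hyps(1) len irred explore_all_types, where B = "{}"])
        (auto simp: reach_empty)
  qed
qed

section \<open>EFX as a lower bound on gains\<close>

lemma receiver_eq: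
  assumes "disjoint_family_on \<pi> {1..n}" "k \<in> {1..n}" "a \<in> \<pi> k"
  shows "receiver n \<pi> a = k"
  unfolding receiver_def
proof (rule the_equality)
  show "k \<in> {1..n} \<and> a \<in> \<pi> k" using assms by simp
  show "i = k" if "i \<in> {1..n} \<and> a \<in> \<pi> i" for i
    using disjoint_family_onD[OF assms(1), of i k] assms that by blast
qed

lemma alloc_value_eq:
  assumes "disjoint_family_on \<pi> {1..n}" "\<And>k. k \<in> {1..n} \<Longrightarrow> finite (\<pi> k)"
  shows "alloc_value n V i \<pi> = (\<Sum>k\<in>{1..n}. \<Sum>a\<in>\<pi> k. V i k a)"
proof -
  have "alloc_value n V i \<pi> = (\<Sum>k\<in>{1..n}. \<Sum>a\<in>\<pi> k. V i (receiver n \<pi> a) a)"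
    unfolding alloc_value_def using assms
    by (intro sum.UNION_disjoint) (auto simp: disjoint_family_on_def)
  also have "\<dots> = (\<Sum>k\<in>{1..n}. \<Sum>a\<in>\<pi> k. V i k a)"
    using receiver_eq[OF assms(1)] by (intro sum.cong refl) simp
  finally show ?thesis .
qed

text \<open>All bundles except those of \<open>i\<close> and \<open>j\<close> cancel; an item of
  these two contributes the loss from moving it from \<open>i\<close> to \<open>j\<close>, with the
  sign given by its present owner.\<close>

lemma alloc_value_swap_diff:
  assumes dis: "disjoint_family_on \<pi> {1..n}" and fin: "\<And>k. k \<in> {1..n} \<Longrightarrow> finite (\<pi> k)"
    and ij: "i \<in> {1..n}" "j \<in> {1..n}"
  shows "alloc_value n V i \<pi> - alloc_value n V i (swap_bundles i j \<pi>)
    = (\<Sum>a\<in>\<pi> i. V i i a - V i j a) - (\<Sum>a\<in>\<pi> j. V i i a - V i j a)"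
proof (cases "i = j")
  case True
  then show ?thesis by (simp add: swap_bundles_def)
next
  case False
  define \<sigma> where "\<sigma> = swap_bundles i j \<pi>"
  have \<sigma>: "\<sigma> i = \<pi> j" "\<sigma> j = \<pi> i" "\<And>k. k \<noteq> i \<Longrightarrow> k \<noteq> j \<Longrightarrow> \<sigma> k = \<pi> k"
    using False by (auto simp: \<sigma>_def swap_bundles_def)
  have dis': "disjoint_family_on \<sigma> {1..n}"
    unfolding disjoint_family_on_def
  proof (intro ballI impI)
    fix k l assume "k \<in> {1..n}" "l \<in> {1..n}" "k \<noteq> l"
    then show "\<sigma> k \<inter> \<sigma> l = {}"
      using dis ij \<sigma> unfolding disjoint_family_on_def by (metis (no_types, lifting))
  qed
  have fin': "finite (\<sigma> k)" if "k \<in> {1..n}" for k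
    using fin ij \<sigma> that by metis
  have split: "(\<Sum>k\<in>{1..n}. f k) = f i + f j + (\<Sum>k\<in>{1..n} - {i, j}. f k)" for f :: "nat \<Rightarrow> real"
  proof -
    have "{1..n} = insert i (insert j ({1..n} - {i, j}))" using ij by auto
    then have "(\<Sum>k\<in>{1..n}. f k) = (\<Sum>k\<in>insert i (insert j ({1..n} - {i, j})). f k)" by simp
    also have "\<dots> = f i + f j + (\<Sum>k\<in>{1..n} - {i, j}. f k)"
      using False by (subst sum.insert; simp)+
    finally show ?thesis .
  qed
  have "(\<Sum>k\<in>{1..n} - {i, j}. \<Sum>a\<in>\<sigma> k. V i k a) = (\<Sum>k\<in>{1..n} - {i, j}. \<Sum>a\<in>\<pi> k. V i k a)"
    by (intro sum.cong) (auto simp: \<sigma>(3))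
  moreover have "alloc_value n V i \<pi> = (\<Sum>k\<in>{1..n}. \<Sum>a\<in>\<pi> k. V i k a)"
    using dis fin by (rule alloc_value_eq)
  moreover have "alloc_value n V i \<sigma> = (\<Sum>k\<in>{1..n}. \<Sum>a\<in>\<sigma> k. V i k a)"
    using dis' fin' by (rule alloc_value_eq)
  ultimately show ?thesis
    unfolding \<sigma>_def[symmetric] split by (simp add: \<sigma>(1,2) sum_subtractf)
qed

text \<open>Removing one item changes the difference by at most 1. EFX only concerns removals that
  raise it; they raise it by exactly 1, hence from at least -1 to at least 0.\<close>

lemma EFX_if_gain_ge:
  assumes alloc: "is_allocation n A \<pi>" and fin: "finite A"
    and bin: "binary_valuations n A V" and nwc: "no_weak_chores n A V"
    and gain: "\<And>i j. i \<in> {1..n} \<Longrightarrow> j \<in> {1..n} \<Longrightarrow> i \<noteq> j \<Longrightarrow>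
      - 1 \<le> (\<Sum>a\<in>\<pi> i. V i i a - V i j a) - (\<Sum>a\<in>\<pi> j. V i i a - V i j a)"
  shows "EFX n A V \<pi>"
  unfolding EFX_def Let_def
proof (intro conjI alloc ballI impI)
  fix i j a
  assume i: "i \<in> {1..n}" and j: "j \<in> {1..n}" and a: "a \<in> A"
    and envy: "alloc_value n V i \<pi> < alloc_value n V i (swap_bundles i j \<pi>)"
    and less: "alloc_value n V i \<pi> - alloc_value n V i (swap_bundles i j \<pi>)
      < alloc_value n V i (remove_item a \<pi>) - alloc_value n V i (swap_bundles i j (remove_item a \<pi>))"
  have sub: "\<pi> k \<subseteq> A" if "k \<in> {1..n}" for k
    using alloc that by (auto simp: is_allocation_def)
  have finp: "finite (\<pi> k)" if "k \<in> {1..n}" for k using sub[OF that] fin finite_subset by blast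
  have dis: "disjoint_family_on \<pi> {1..n}" using alloc by (simp add: is_allocation_def)
  have dis': "disjoint_family_on (remove_item a \<pi>) {1..n}"
    using dis by (auto simp: disjoint_family_on_def remove_item_def)
  have finp': "finite (remove_item a \<pi> k)" if "k \<in> {1..n}" for k
    using finp[OF that] by (simp add: remove_item_def)
  define d where "d b = V i i b - V i j b" for b
  \<comment> \<open>Binary values leave -1, 0 and 1; the value -1 would make \<open>a\<close> a
    weak-chore for \<open>i\<close>.\<close>
  have d: "d a \<in> {0, 1}"
    using bin nwc i j a
    unfolding d_def binary_valuations_def no_weak_chores_def weak_chore_def
    by (metis (no_types, lifting) diff_0_right diff_self insert_iff less_numeral_extra(1) singletonD)
  have ne: "i \<noteq> j" using envy by (auto simp: swap_bundles_def)
  have E: "alloc_value n V i \<pi> - alloc_value n V i (swap_bundles i j \<pi>)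
      = (\<Sum>b\<in>\<pi> i. d b) - (\<Sum>b\<in>\<pi> j. d b)"
    unfolding d_def using dis finp i j by (rule alloc_value_swap_diff)
  have E': "alloc_value n V i (remove_item a \<pi>) - alloc_value n V i (swap_bundles i j (remove_item a \<pi>))
      = (\<Sum>b\<in>remove_item a \<pi> i. d b) - (\<Sum>b\<in>remove_item a \<pi> j. d b)"
    unfolding d_def using dis' finp' i j by (rule alloc_value_swap_diff)
  have rem: "(\<Sum>b\<in>remove_item a \<pi> k. d b) = (\<Sum>b\<in>\<pi> k. d b) - (if a \<in> \<pi> k then d a else 0)"
    if "k \<in> {1..n}" for k
    using finp[OF that] by (simp add: remove_item_def sum_diff1)
  have "(\<Sum>b\<in>remove_item a \<pi> i. d b) - (\<Sum>b\<in>remove_item a \<pi> j. d b) \<ge> 0"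
    using less gain[OF i j ne, folded d_def] d unfolding E E' rem[OF i] rem[OF j]
    by (auto split: if_splits)
  then show "alloc_value n V i (swap_bundles i j (remove_item a \<pi>)) \<le> alloc_value n V i (remove_item a \<pi>)"
    using E' by simp
qed

text \<open>The contribution of an item given to \<open>k\<close> to the difference of the two sums in
  \<open>EFX_if_gain_ge\<close>; \<open>b\<close> states that agent \<open>i\<close> cares.\<close>

definition gain :: "nat \<Rightarrow> nat \<Rightarrow> nat \<Rightarrow> bool \<Rightarrow> int" where
  "gain i j k b = (if b \<and> k = i then 1 else if b \<and> k = j then -1 else 0)"

definition alloc_of :: "'a set \<Rightarrow> ('a \<Rightarrow> nat) \<Rightarrow> 'a alloc" where
  "alloc_of A p = (\<lambda>i. {a \<in> A. p a = i})"

lemma EFX_alloc_of: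
  assumes fin: "finite A" and bin: "binary_valuations n A V" and nwc: "no_weak_chores n A V"
    and p: "\<And>a. a \<in> A \<Longrightarrow> p a \<in> {1..n}"
    and gain: "\<And>i j. i \<in> {1..n} \<Longrightarrow> j \<in> {1..n} \<Longrightarrow> i \<noteq> j \<Longrightarrow>
      - 1 \<le> (\<Sum>a\<in>A. gain i j (p a) (V i j a \<noteq> V i i a))"
  shows "EFX n A V (alloc_of A p)"
proof (rule EFX_if_gain_ge[OF _ fin bin nwc])
  show "is_allocation n A (alloc_of A p)"
    using p by (auto simp: is_allocation_def alloc_of_def disjoint_family_on_def)
next
  fix i j assume ij: "i \<in> {1..n}" "j \<in> {1..n}" "i \<noteq> j"
  \<comment> \<open>Unequal values can only be 1 for \<open>i\<close> keeping the item and 0 for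
    \<open>j\<close> getting it.\<close>
  have d: "V i i a - V i j a = of_bool (V i j a \<noteq> V i i a)" if "a \<in> A" for a
  proof -
    have "V i i a \<in> {0, 1}" "V i j a \<in> {0, 1}" "\<not> V i i a < V i j a"
      using bin nwc ij that by (auto simp: binary_valuations_def no_weak_chores_def weak_chore_def)
    then show ?thesis by auto
  qed
  have part: "(\<Sum>a\<in>alloc_of A p k. f a) = (\<Sum>a\<in>A. if p a = k then f a else 0)" for k and f :: "'a \<Rightarrow> real"
    unfolding alloc_of_def using fin by (rule sum.inter_filter)
  have "(\<Sum>a\<in>alloc_of A p i. V i i a - V i j a) - (\<Sum>a\<in>alloc_of A p j. V i i a - V i j a)
    = (\<Sum>a\<in>A. real_of_int (gain i j (p a) (V i j a \<noteq> V i i a)))"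
    unfolding part sum_subtractf[symmetric]
    using ij(3) by (intro sum.cong) (auto simp: d gain_def)
  also have "\<dots> = real_of_int (\<Sum>a\<in>A. gain i j (p a) (V i j a \<noteq> V i i a))" by simp
  also have "\<dots> \<ge> - 1" using gain[OF ij] by linarith
  finally show "- 1 \<le> (\<Sum>a\<in>alloc_of A p i. V i i a - V i j a) - (\<Sum>a\<in>alloc_of A p j. V i i a - V i j a)" .
qed

text \<open>Matches the six coordinates of the search with ordered pairs of agents. As
  \<open>b\<close> is arbitrary, this serves both the given items and the leftover copies in the
  algorithm.\<close>

lemma balanced_assignment:
  fixes b :: "nat \<Rightarrow> nat \<Rightarrow> 'a \<Rightarrow> bool"
  assumes "finite A"
  shows "\<exists>p. (\<forall>a. p a \<in> {1..3}) \<and>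
    (\<forall>i\<in>{1..3}. \<forall>j\<in>{1..3}. i \<noteq> j \<longrightarrow> - 1 \<le> (\<Sum>a\<in>A. gain i j (p a) (b i j a)))"
proof -
  define ty where "ty a = opts [b 1 2 a, b 1 3 a, b 2 1 a, b 2 3 a, b 3 1 a, b 3 2 a]" for a
  have "\<exists>u\<in>reach ty A. vge (- 1) u"
    unfolding ty_def using assms by (intro balanced_choice_exists imageI CollectI) auto
  then obtain p where p: "\<And>a. a \<in> A \<Longrightarrow> p a < length (ty a)" and u: "vge (- 1) (gain_total ty p A)"
    by (auto simp: reach_def)
  \<comment> \<open>Options are indexed from 0, agents from 1; the default 1 outside
    \<open>A\<close> makes every value of \<open>r\<close> an agent.\<close>
  define r where "r a = (if a \<in> A then Suc (p a) else 1)" for a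
  have c: "- 1 \<le> (\<Sum>a\<in>A. step_val (ty a ! p a ! c))" if "c < 6" for c
    using u that by (auto simp: vge_def gain_total_def)
  have p3: "p a \<in> {0, 1, 2}" if "a \<in> A" for a
    using p[OF that] by (auto simp: ty_def)
  have coord: "(\<Sum>a\<in>A. gain i j (r a) (b i j a)) = (\<Sum>a\<in>A. step_val (ty a ! p a ! c))"
    if "(i, j, c) \<in> {(1, 2, 0), (1, 3, 1), (2, 1, 2), (2, 3, 3), (3, 1, 4), (3, 2, 5)}" for i j c
  proof (rule sum.cong[OF refl])
    fix a assume "a \<in> A"
    then show "gain i j (r a) (b i j a) = step_val (ty a ! p a ! c)"
      using p3[OF \<open>a \<in> A\<close>] that unfolding insert_iff empty_iff prod.inject
      by (elim disjE conjE FalseE; simp add: r_def ty_def gain_def pos_def neg_def)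
  qed
  have "- 1 \<le> (\<Sum>a\<in>A. gain i j (r a) (b i j a))"
    if "i \<in> {1..3}" "j \<in> {1..3}" "i \<noteq> j" for i j
  proof -
    have "{1..3} = {1, 2, 3::nat}" by auto
    then have "\<exists>c<6. (i, j, c) \<in> {(1, 2, 0), (1, 3, 1), (2, 1, 2), (2, 3, 3), (3, 1, 4), (3, 2, 5 :: nat)}"
      using that by auto
    then obtain c where "c < 6"
      "(i, j, c) \<in> {(1, 2, 0), (1, 3, 1), (2, 1, 2), (2, 3, 3), (3, 1, 4), (3, 2, 5 :: nat)}" by blast
    then show ?thesis using coord[of i j c] c[of c] by simp
  qed
  moreover have "r a \<in> {1..3}" for a using p3[of a] by (auto simp: r_def)
  ultimately show ?thesis by blast
qed

lemma EFX_exists: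
  assumes "finite A" "binary_valuations 3 A V" "no_weak_chores 3 A V"
  shows "\<exists>\<pi>. EFX 3 A V \<pi>"
proof -
  obtain p where "\<forall>a. p a \<in> {1..3}"
    "\<forall>i\<in>{1..3}. \<forall>j\<in>{1..3}. i \<noteq> j \<longrightarrow> - 1 \<le> (\<Sum>a\<in>A. gain i j (p a) (V i j a \<noteq> V i i a))"
    using balanced_assignment[OF assms(1), of "\<lambda>i j a. V i j a \<noteq> V i i a"] by blast
  then have "EFX 3 A V (alloc_of A p)" using assms by (intro EFX_alloc_of) auto
  then show ?thesis by blast
qed

section \<open>Finite transducers as WHILE programs\<close>

fun const_expr :: "tree \<Rightarrow> expr" where
  "const_expr Leaf = Leaf_E"
| "const_expr (Node l r) = Node_E (const_expr l) (const_expr r)"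

lemma eval_const_expr [simp]: "eval_expr (const_expr d) s = d"
  by (induction d) auto

text \<open>Only leaf tests exist, so comparison with a fixed tree is unfolded along that tree. The
  outer test separates \<open>Leaf\<close> from \<open>Node Leaf Leaf\<close>, as both selectors map
  \<open>Leaf\<close> to \<open>Leaf\<close>.\<close>

fun if_eq :: "expr \<Rightarrow> tree \<Rightarrow> com \<Rightarrow> com \<Rightarrow> com" where
  "if_eq e Leaf c c' = Cond e c' c"
| "if_eq e (Node l r) c c' = Cond e (if_eq (Left_E e) l (if_eq (Right_E e) r c c') c') c'"

fun if_eq_time :: "expr \<Rightarrow> tree \<Rightarrow> nat" where
  "if_eq_time e Leaf = 1 + expr_time e"
| "if_eq_time e (Node l r) = 1 + expr_time e + if_eq_time (Left_E e) l + if_eq_time (Right_E e) r"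

text \<open>The induction generalises over \<open>c\<close> because the test of the right subtree is
  the success branch of the test of the left one. The bound does not depend on the store.\<close>

lemma exec_if_eq:
  "exec (if eval_expr e s = d then c else c') s t s'
    \<Longrightarrow> \<exists>u\<le>if_eq_time e d + t. exec (if_eq e d c c') s u s'"
proof (induction d arbitrary: e c t)
  case Leaf
  show ?case
  proof (cases "eval_expr e s = Leaf")
    case True
    then show ?thesis using Leaf exec_CondFalse[OF True, of c t s' c'] by auto
  next
    case False
    then show ?thesis using Leaf exec_CondTrue[OF False, of c' t s' c] by auto
  qed
next
  case (Node l r)
  show ?case
  proof (cases "eval_expr e s")
    case Leaf
    then show ?thesis
      using Node.prems exec_CondFalse[of e s c' t s' "if_eq (Left_E e) l (if_eq (Right_E e) r c c') c'"]
      by (intro exI[of _ "1 + expr_time e + t"]) simp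
  next
    case (Node l' r')
    have "\<exists>u\<le>if_eq_time (Right_E e) r + t.
        exec (if l' = l then if_eq (Right_E e) r c c' else c') s u s'"
    proof (cases "l' = l")
      case True
      then show ?thesis using Node.IH(2)[of "Right_E e" c t] Node.prems Node by simp
    next
      case False
      then show ?thesis using Node.prems Node by (intro exI[of _ t]) simp
    qed
    then obtain u where u: "u \<le> if_eq_time (Right_E e) r + t"
      "exec (if l' = l then if_eq (Right_E e) r c c' else c') s u s'" by blast
    then obtain v where v: "v \<le> if_eq_time (Left_E e) l + u"
      "exec (if_eq (Left_E e) l (if_eq (Right_E e) r c c') c') s v s'"
      using Node.IH(1)[of "Left_E e" "if_eq (Right_E e) r c c'" u] Node by auto
    have "exec (if_eq e (Node l r) c c') s (1 + expr_time e + v) s'"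
      using exec_CondTrue[OF _ v(2)] Node by simp
    then show ?thesis using u(1) v(1)
      by (intro exI[of _ "1 + expr_time e + v"]) simp
  qed
qed

text \<open>Nothing is known about \<open>f\<close>: a finite table is stored in the program.\<close>

lemma table_lookup:
  assumes "finite F"
  shows "\<exists>c B. \<forall>s. s x \<in> F \<longrightarrow> (\<exists>t\<le>B. exec c s t (s(y := f (s x))))"
  using assms
proof (induction rule: finite_induct)
  case empty
  then show ?case by simp
next
  case (insert d F)
  then obtain c B where c: "\<And>s. s x \<in> F \<Longrightarrow> \<exists>t\<le>B. exec c s t (s(y := f (s x)))" by blast
  define a where "a = Assign y (const_expr (f d))"
  define T where "T = if_eq_time (Var x) d + (1 + expr_time (const_expr (f d)) + B)"
  have "\<exists>t\<le>T. exec (if_eq (Var x) d a c) s t (s(y := f (s x)))" if s: "s x \<in> insert d F" for s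
  proof -
    have "\<exists>t\<le>1 + expr_time (const_expr (f d)) + B.
        exec (if eval_expr (Var x) s = d then a else c) s t (s(y := f (s x)))"
    proof (cases "s x = d")
      case True
      then have "exec a s (1 + expr_time (const_expr (f d))) (s(y := f (s x)))"
        using exec_Assign[of y "const_expr (f d)" s] by (simp add: a_def)
      then show ?thesis using True by (intro exI[of _ "1 + expr_time (const_expr (f d))"]) simp
    next
      case False
      then obtain t where "t \<le> B" "exec c s t (s(y := f (s x)))" using c[of s] s by auto
      then show ?thesis using False by (intro exI[of _ t]) simp
    qed
    then show ?thesis unfolding T_def using exec_if_eq[of "Var x" s d a c]
      by (meson add_left_mono le_trans)
  qed
  then show ?case by blast
qed

lemma finite_inj_enc:
  assumes "finite Q"
  shows "\<exists>e :: 'q \<Rightarrow> tree. inj_on e Q"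
proof -
  obtain f :: "'q \<Rightarrow> nat" where f: "inj_on f Q"
    using finite_imp_inj_to_nat_seg[OF assms] by blast
  have len: "length (replicate k Leaf) = k" for k by simp
  have "inj enc_list"
  proof (rule injI)
    fix xs ys :: "tree list"
    show "enc_list xs = enc_list ys \<Longrightarrow> xs = ys"
      by (induction xs arbitrary: ys; case_tac ys) auto
  qed
  then have "inj enc_nat"
    unfolding enc_nat_def by (intro injI) (metis injD len)
  then have "inj_on (enc_nat \<circ> f) Q" using f by (simp add: comp_inj_on inj_on_subset)
  then show ?thesis by blast
qed

text \<open>State and letter are packed into one tree, so a table with one argument suffices;
  \<open>inv_into\<close> recovers the state.\<close>

lemma transition_lookup:
  assumes "finite Q" "finite L" "inj_on e Q"
  shows "\<exists>c B. \<forall>s q l. s 3 = Node (e q) l \<and> q \<in> Q \<and> l \<in> L \<longrightarrow> (\<exists>t\<le>B. exec c s t (s(2 := f q l)))"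
proof -
  define F where "F = (\<lambda>(q, l). Node (e q) l) ` (Q \<times> L)"
  have "finite F" using assms(1,2) by (simp add: F_def)
  from table_lookup[OF this, of 3 2 "\<lambda>d. f (inv_into Q e (left d)) (right d)"]
  obtain c B where c: "\<And>s. s 3 \<in> F \<Longrightarrow>
      \<exists>t\<le>B. exec c s t (s(2 := f (inv_into Q e (left (s 3))) (right (s 3))))" by blast
  have "\<exists>t\<le>B. exec c s t (s(2 := f q l))" if "s 3 = Node (e q) l" "q \<in> Q" "l \<in> L" for s q l
  proof -
    have "s 3 \<in> F" using that by (force simp: F_def)
    then show ?thesis using c[of s] that assms(3) by (simp add: inv_into_f_f)
  qed
  then show ?thesis by blast
qed

text \<open>Variable 0 holds the input and later the output, 1 the reversed input, 2 the state of the
  transducer; 3 is the argument of the table lookup.\<close>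

definition scan_step :: "com \<Rightarrow> com" where
  "scan_step c = Seq (Assign 3 (Node_E (Var 2) (Left_E (Var 0)))) (Seq c
     (Seq (Assign 1 (Node_E (Left_E (Var 0)) (Var 1))) (Assign 0 (Right_E (Var 0)))))"

definition emit_step :: "com \<Rightarrow> com" where
  "emit_step c = Seq (Assign 3 (Node_E (Var 2) (Left_E (Var 1)))) (Seq c
     (Seq (Assign 0 (Node_E (Right_E (Var 2)) (Var 0)))
     (Seq (Assign 2 (Left_E (Var 2))) (Assign 1 (Right_E (Var 1))))))"

text \<open>A round costs 2 for the loop test, 13 for the assignments and at most \<open>B\<close>
  for the lookup; the last test costs 2.\<close>

lemma exec_scan:
  assumes c: "\<And>s q l. s 3 = Node (e q) l \<Longrightarrow> q \<in> Q \<Longrightarrow> l \<in> L \<Longrightarrow> \<exists>t\<le>B. exec c s t (s(2 := e (\<delta> l q)))"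
    and closed: "\<And>q l. q \<in> Q \<Longrightarrow> l \<in> L \<Longrightarrow> \<delta> l q \<in> Q"
  shows "set w \<subseteq> L \<Longrightarrow> q \<in> Q \<Longrightarrow> s 0 = enc_list w \<Longrightarrow> s 1 = enc_list r \<Longrightarrow> s 2 = e q \<Longrightarrow>
    \<exists>t s'. exec (While (Var 0) (scan_step c)) s t s' \<and> t \<le> 2 + (15 + B) * length w \<and>
      s' 0 = Leaf \<and> s' 1 = enc_list (rev w @ r) \<and> s' 2 = e (fold \<delta> w q)"
proof (induction w arbitrary: q s r)
  case Nil
  then show ?case using exec_WhileFalse[of "Var 0" s "scan_step c"]
    by (intro exI[of _ 2] exI[of _ s]) (simp add: numeral_2_eq_2)
next
  case (Cons l w)
  define s1 where "s1 = s(3 := Node (e q) l)"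
  have "s1 3 = Node (e q) l" by (simp add: s1_def)
  then obtain t where t: "t \<le> B" "exec c s1 t (s1(2 := e (\<delta> l q)))"
    using c[of s1 q l] Cons.prems by auto
  define s2 where "s2 = s1(2 := e (\<delta> l q))"
  define s3 where "s3 = s2(1 := Node l (s 1))"
  define s4 where "s4 = s3(0 := enc_list w)"
  have a1: "exec (Assign 3 (Node_E (Var 2) (Left_E (Var 0)))) s 5 s1"
    using exec_Assign[of 3 "Node_E (Var 2) (Left_E (Var 0))" s] Cons.prems by (simp add: s1_def numeral_eq_Suc)
  have a2: "exec (Assign 1 (Node_E (Left_E (Var 0)) (Var 1))) s2 5 s3"
    using exec_Assign[of 1 "Node_E (Left_E (Var 0)) (Var 1)" s2] Cons.prems
    by (simp add: s1_def s2_def s3_def numeral_eq_Suc)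
  have a3: "exec (Assign 0 (Right_E (Var 0))) s3 3 s4"
    using exec_Assign[of 0 "Right_E (Var 0)" s3] Cons.prems
    by (simp add: s1_def s2_def s3_def s4_def numeral_eq_Suc)
  have body: "exec (scan_step c) s (5 + (t + (5 + 3))) s4"
    unfolding scan_step_def using a1 t(2)[folded s2_def] a2 a3 by (intro exec_Seq)
  have "\<exists>u s'. exec (While (Var 0) (scan_step c)) s4 u s' \<and> u \<le> 2 + (15 + B) * length w \<and>
      s' 0 = Leaf \<and> s' 1 = enc_list (rev w @ (l # r)) \<and> s' 2 = e (fold \<delta> w (\<delta> l q))"
    using Cons.prems closed by (intro Cons.IH) (auto simp: s1_def s2_def s3_def s4_def)
  then obtain u s' where u: "exec (While (Var 0) (scan_step c)) s4 u s'" "u \<le> 2 + (15 + B) * length w"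
    "s' 0 = Leaf" "s' 1 = enc_list (rev w @ (l # r))" "s' 2 = e (fold \<delta> w (\<delta> l q))" by blast
  have "exec (While (Var 0) (scan_step c)) s (1 + expr_time (Var 0) + (5 + (t + (5 + 3))) + u) s'"
    using Cons.prems(3) by (intro exec_WhileTrue[OF _ body u(1)]) simp
  moreover have "1 + expr_time (Var 0) + (5 + (t + (5 + 3))) + u \<le> 2 + (15 + B) * length (l # w)"
    using t(1) u(2) by simp
  ultimately show ?case using u(3-5) by fastforce
qed

text \<open>A Mealy machine: each output uses the state before the transition.\<close>

fun outputs :: "('l \<Rightarrow> 'q \<Rightarrow> 'q) \<Rightarrow> ('l \<Rightarrow> 'q \<Rightarrow> 'o) \<Rightarrow> 'q \<Rightarrow> 'l list \<Rightarrow> 'o list" where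
  "outputs \<delta> \<omega> q [] = []"
| "outputs \<delta> \<omega> q (l # w) = \<omega> l q # outputs \<delta> \<omega> (\<delta> l q) w"

lemma exec_emit:
  assumes c: "\<And>s q l. s 3 = Node (e q) l \<Longrightarrow> q \<in> Q \<Longrightarrow> l \<in> L
      \<Longrightarrow> \<exists>t\<le>B. exec c s t (s(2 := Node (e (\<delta> l q)) (\<omega> l q)))"
    and closed: "\<And>q l. q \<in> Q \<Longrightarrow> l \<in> L \<Longrightarrow> \<delta> l q \<in> Q"
  shows "set w \<subseteq> L \<Longrightarrow> q \<in> Q \<Longrightarrow> s 0 = enc_list r \<Longrightarrow> s 1 = enc_list w \<Longrightarrow> s 2 = e q \<Longrightarrow>
    \<exists>t s'. exec (While (Var 1) (emit_step c)) s t s' \<and> t \<le> 2 + (18 + B) * length w \<and>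
      s' 0 = enc_list (rev (outputs \<delta> \<omega> q w) @ r)"
proof (induction w arbitrary: q s r)
  case Nil
  then show ?case using exec_WhileFalse[of "Var 1" s "emit_step c"]
    by (intro exI[of _ 2] exI[of _ s]) (simp add: numeral_2_eq_2)
next
  case (Cons l w)
  define s1 where "s1 = s(3 := Node (e q) l)"
  have "s1 3 = Node (e q) l" by (simp add: s1_def)
  then obtain t where t: "t \<le> B" "exec c s1 t (s1(2 := Node (e (\<delta> l q)) (\<omega> l q)))"
    using c[of s1 q l] Cons.prems by auto
  define s2 where "s2 = s1(2 := Node (e (\<delta> l q)) (\<omega> l q))"
  define s3 where "s3 = s2(0 := Node (\<omega> l q) (s 0))"
  define s4 where "s4 = s3(2 := e (\<delta> l q))"
  define s5 where "s5 = s4(1 := enc_list w)"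
  have a1: "exec (Assign 3 (Node_E (Var 2) (Left_E (Var 1)))) s 5 s1"
    using exec_Assign[of 3 "Node_E (Var 2) (Left_E (Var 1))" s] Cons.prems by (simp add: s1_def numeral_eq_Suc)
  have a2: "exec (Assign 0 (Node_E (Right_E (Var 2)) (Var 0))) s2 5 s3"
    using exec_Assign[of 0 "Node_E (Right_E (Var 2)) (Var 0)" s2] Cons.prems
    by (simp add: s1_def s2_def s3_def numeral_eq_Suc)
  have a3: "exec (Assign 2 (Left_E (Var 2))) s3 3 s4"
    using exec_Assign[of 2 "Left_E (Var 2)" s3] Cons.prems
    by (simp add: s1_def s2_def s3_def s4_def numeral_eq_Suc)
  have a4: "exec (Assign 1 (Right_E (Var 1))) s4 3 s5"
    using exec_Assign[of 1 "Right_E (Var 1)" s4] Cons.prems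
    by (simp add: s1_def s2_def s3_def s4_def s5_def numeral_eq_Suc)
  have body: "exec (emit_step c) s (5 + (t + (5 + (3 + 3)))) s5"
    unfolding emit_step_def using a1 t(2)[folded s2_def] a2 a3 a4 by (intro exec_Seq)
  have "\<exists>u s'. exec (While (Var 1) (emit_step c)) s5 u s' \<and> u \<le> 2 + (18 + B) * length w \<and>
      s' 0 = enc_list (rev (outputs \<delta> \<omega> (\<delta> l q) w) @ (\<omega> l q # r))"
    using Cons.prems closed by (intro Cons.IH) (auto simp: s1_def s2_def s3_def s4_def s5_def)
  then obtain u s' where u: "exec (While (Var 1) (emit_step c)) s5 u s'" "u \<le> 2 + (18 + B) * length w"
    "s' 0 = enc_list (rev (outputs \<delta> \<omega> (\<delta> l q) w) @ (\<omega> l q # r))" by blast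
  have "exec (While (Var 1) (emit_step c)) s (1 + expr_time (Var 1) + (5 + (t + (5 + (3 + 3)))) + u) s'"
    using Cons.prems(4) by (intro exec_WhileTrue[OF _ body u(1)]) simp
  moreover have "1 + expr_time (Var 1) + (5 + (t + (5 + (3 + 3)))) + u \<le> 2 + (18 + B) * length (l # w)"
    using t(1) u(2) by simp
  ultimately show ?case using u(3) by fastforce
qed

text \<open>The second pass reads the reversed input, and pushing its outputs reverses them again,
  so the answer is in the order of \<open>w\<close>. Between the passes, \<open>h\<close> is one
  lookup in a finite table.\<close>

lemma two_pass_computable:
  fixes \<delta>\<^sub>1 :: "tree \<Rightarrow> 'q \<Rightarrow> 'q" and \<delta>\<^sub>2 :: "tree \<Rightarrow> 'p \<Rightarrow> 'p" and \<omega> :: "tree \<Rightarrow> 'p \<Rightarrow> tree" and h :: "'q \<Rightarrow> 'p"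
  assumes "finite Q" "finite P" "finite L" and q0: "q\<^sub>0 \<in> Q" and h: "\<And>q. q \<in> Q \<Longrightarrow> h q \<in> P"
    and closed1: "\<And>q l. q \<in> Q \<Longrightarrow> l \<in> L \<Longrightarrow> \<delta>\<^sub>1 l q \<in> Q"
    and closed2: "\<And>q l. q \<in> P \<Longrightarrow> l \<in> L \<Longrightarrow> \<delta>\<^sub>2 l q \<in> P"
  shows "\<exists>c K. \<forall>w. set w \<subseteq> L \<longrightarrow> (\<exists>t\<le>K * (length w + 1). computes_in c (enc_list w)
    (enc_list (rev (outputs \<delta>\<^sub>2 \<omega> (h (fold \<delta>\<^sub>1 w q\<^sub>0)) (rev w)))) t)"
proof -
  obtain e1 :: "'q \<Rightarrow> tree" where e1: "inj_on e1 Q" using finite_inj_enc[OF \<open>finite Q\<close>] by blast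
  obtain e2 :: "'p \<Rightarrow> tree" where e2: "inj_on e2 P" using finite_inj_enc[OF \<open>finite P\<close>] by blast
  obtain c1 B1 where c1: "\<And>s q l. s 3 = Node (e1 q) l \<Longrightarrow> q \<in> Q \<Longrightarrow> l \<in> L
      \<Longrightarrow> \<exists>t\<le>B1. exec c1 s t (s(2 := e1 (\<delta>\<^sub>1 l q)))"
    using transition_lookup[OF assms(1,3) e1, of "\<lambda>q l. e1 (\<delta>\<^sub>1 l q)"] by blast
  obtain c2 B2 where c2: "\<And>s q l. s 3 = Node (e2 q) l \<Longrightarrow> q \<in> P \<Longrightarrow> l \<in> L
      \<Longrightarrow> \<exists>t\<le>B2. exec c2 s t (s(2 := Node (e2 (\<delta>\<^sub>2 l q)) (\<omega> l q)))"
    using transition_lookup[OF assms(2,3) e2, of "\<lambda>q l. Node (e2 (\<delta>\<^sub>2 l q)) (\<omega> l q)"] by blast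
  obtain ch Bh where ch: "\<And>s. s 2 \<in> e1 ` Q \<Longrightarrow>
      \<exists>t\<le>Bh. exec ch s t (s(2 := e2 (h (inv_into Q e1 (s 2)))))"
    using table_lookup[of "e1 ` Q" 2 2 "\<lambda>d. e2 (h (inv_into Q e1 d))"] assms(1) by blast
  define k where "k = 1 + expr_time (const_expr (e1 q\<^sub>0))"
  define c where "c = Seq (Assign 2 (const_expr (e1 q\<^sub>0))) (Seq (While (Var 0) (scan_step c1))
    (Seq ch (While (Var 1) (emit_step c2))))"
  \<comment> \<open>Apart from lookups, the passes cost 15 + 18 per letter and 4 for the final
    tests; 40 covers either.\<close>
  define K where "K = k + Bh + B1 + B2 + 40"
  have "\<exists>t\<le>K * (length w + 1). computes_in c (enc_list w)
    (enc_list (rev (outputs \<delta>\<^sub>2 \<omega> (h (fold \<delta>\<^sub>1 w q\<^sub>0)) (rev w)))) t" if w: "set w \<subseteq> L" for w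
  proof -
    define s0 where "s0 = (\<lambda>_::nat. Leaf)(0 := enc_list w)"
    define s1 where "s1 = s0(2 := e1 q\<^sub>0)"
    have x1: "exec (Assign 2 (const_expr (e1 q\<^sub>0))) s0 k s1"
      using exec_Assign[of 2 "const_expr (e1 q\<^sub>0)" s0] by (simp add: k_def s1_def)
    have "\<exists>t s'. exec (While (Var 0) (scan_step c1)) s1 t s' \<and> t \<le> 2 + (15 + B1) * length w \<and>
      s' 0 = Leaf \<and> s' 1 = enc_list (rev w @ []) \<and> s' 2 = e1 (fold \<delta>\<^sub>1 w q\<^sub>0)"
      using w q0 by (intro exec_scan[where Q = Q and L = L] c1 closed1) (auto simp: s1_def s0_def)
    then obtain t2 s2 where x2: "exec (While (Var 0) (scan_step c1)) s1 t2 s2"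
      "t2 \<le> 2 + (15 + B1) * length w" "s2 0 = Leaf" "s2 1 = enc_list (rev w)" "s2 2 = e1 (fold \<delta>\<^sub>1 w q\<^sub>0)"
      by auto
    have "fold \<delta>\<^sub>1 w q \<in> Q" if "q \<in> Q" for q
      using w that by (induction w arbitrary: q) (auto simp: closed1)
    then have q: "fold \<delta>\<^sub>1 w q\<^sub>0 \<in> Q" using q0 .
    define s3 where "s3 = s2(2 := e2 (h (fold \<delta>\<^sub>1 w q\<^sub>0)))"
    obtain t3 where x3: "t3 \<le> Bh" "exec ch s2 t3 s3"
      using ch[of s2] x2(5) q e1 by (auto simp: s3_def inv_into_f_f)
    have "\<exists>t s'. exec (While (Var 1) (emit_step c2)) s3 t s' \<and> t \<le> 2 + (18 + B2) * length (rev w) \<and>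
      s' 0 = enc_list (rev (outputs \<delta>\<^sub>2 \<omega> (h (fold \<delta>\<^sub>1 w q\<^sub>0)) (rev w)) @ [])"
      using w h[OF q] x2
      by (intro exec_emit[where e = e2 and Q = P and L = L] c2 closed2) (auto simp: s3_def)
    then obtain t4 s4 where x4: "exec (While (Var 1) (emit_step c2)) s3 t4 s4"
      "t4 \<le> 2 + (18 + B2) * length w"
      "s4 0 = enc_list (rev (outputs \<delta>\<^sub>2 \<omega> (h (fold \<delta>\<^sub>1 w q\<^sub>0)) (rev w)))" by auto
    have "exec c s0 (k + (t2 + (t3 + t4))) s4"
      unfolding c_def using x1 x2(1) x3(2) x4(1) by (intro exec_Seq)
    moreover have "k + (t2 + (t3 + t4)) \<le> K * (length w + 1)"
      using x2(2) x3(1) x4(2) by (simp add: K_def algebra_simps)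
    ultimately show ?thesis using x4(3) unfolding computes_in_def s0_def by blast
  qed
  then show ?thesis by blast
qed

section \<open>The algorithm\<close>

text \<open>
  The second pass keeps, for every kind of item, a queue of receivers, which is refilled with the
  three agents when it runs empty. A full refill does not change the sum of the values in a queue,
  and all queues end up empty if their initial lengths are the numbers of items modulo 3.
\<close>

definition refill :: "nat list \<Rightarrow> nat list" where
  "refill rs = (if rs = [] then [1, 2, 3] else rs)"

definition front :: "'l \<Rightarrow> ('l \<Rightarrow> nat list) \<Rightarrow> nat" where
  "front l g = hd (refill (g l))"

definition pop :: "'l \<Rightarrow> ('l \<Rightarrow> nat list) \<Rightarrow> 'l \<Rightarrow> nat list" where
  "pop l g = g(l := tl (refill (g l)))"

text \<open>At most two receivers remain after a refill and a removal; the length bound makes the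
  state set finite for finite \<open>L\<close>.\<close>

definition queues :: "'l set \<Rightarrow> ('l \<Rightarrow> nat list) set" where
  "queues L = L \<rightarrow>\<^sub>E {rs. set rs \<subseteq> {1..3} \<and> length rs \<le> 2}"

definition pending :: "('l \<Rightarrow> nat \<Rightarrow> int) \<Rightarrow> 'l set \<Rightarrow> ('l \<Rightarrow> nat list) \<Rightarrow> int" where
  "pending val L g = (\<Sum>l\<in>L. sum_list (map (val l) (g l)))"

lemma refill_cases: "refill (g l) = front l g # pop l g l"
  by (simp add: refill_def front_def pop_def)

lemma finite_queues: "finite L \<Longrightarrow> finite (queues L)"
  unfolding queues_def
  by (intro finite_PiE) (auto intro: finite_lists_length_le)

lemma queue_bounds:
  assumes "g \<in> queues L" "l \<in> L"
  shows "set (g l) \<subseteq> {1..3}" "length (g l) \<le> 2"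
proof -
  have "g l \<in> {rs. set rs \<subseteq> {1..3} \<and> length rs \<le> 2}"
    using assms unfolding queues_def by (rule PiE_mem)
  then show "set (g l) \<subseteq> {1..3}" "length (g l) \<le> 2" by auto
qed

lemma pop_in_queues:
  assumes g: "g \<in> queues L" and l: "l \<in> L"
  shows "pop l g \<in> queues L"
proof -
  have "tl (refill (g l)) \<in> {rs. set rs \<subseteq> {1..3} \<and> length rs \<le> 2}"
    using queue_bounds[OF g l] by (cases "g l") (auto simp: refill_def)
  then have "pop l g \<in> insert l L \<rightarrow>\<^sub>E {rs. set rs \<subseteq> {1..3} \<and> length rs \<le> 2}"
    using g unfolding queues_def pop_def by (intro PiE_fun_upd)
  then show ?thesis using l by (simp add: queues_def insert_absorb)
qed

lemma front_in: "g \<in> queues L \<Longrightarrow> l \<in> L \<Longrightarrow> front l g \<in> {1..3}"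
  using queue_bounds[of g L l] by (cases "g l") (auto simp: refill_def front_def)

lemma fold_pop_in_queues: "g \<in> queues L \<Longrightarrow> set w \<subseteq> L \<Longrightarrow> fold pop w g \<in> queues L"
  by (induction w arbitrary: g) (auto simp: pop_in_queues)

lemma length_outputs [simp]: "length (outputs \<delta> \<omega> q w) = length w"
  by (induction w arbitrary: q) auto

lemma map_outputs: "map f (outputs \<delta> \<omega> q w) = outputs \<delta> (\<lambda>l q. f (\<omega> l q)) q w"
  by (induction w arbitrary: q) auto

lemma set_outputs: "g \<in> queues L \<Longrightarrow> set w \<subseteq> L \<Longrightarrow> set (outputs pop front g w) \<subseteq> {1..3}"
proof (induction w arbitrary: g)
  case (Cons l w)
  then show ?case using front_in[of g L l] pop_in_queues[of g L l] by auto
qed simp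

text \<open>Each occurrence of \<open>l\<close> shortens its queue by one modulo 3, as an empty
  queue turns into one of length 2.\<close>

lemma length_fold_pop:
  "(length (fold pop w g l) + count_list w l) mod 3 = length (g l) mod 3"
proof (induction w arbitrary: g)
  case (Cons k w)
  have "(length (pop l g l) + 1) mod 3 = length (g l) mod 3"
    by (cases "g l") (auto simp: pop_def refill_def)
  moreover have "pop k g l = g l" if "k \<noteq> l" using that by (simp add: pop_def)
  moreover have "count_list (k # w) l = (if k = l then 1 else 0) + count_list w l" by simp
  ultimately show ?case using Cons.IH[of "pop k g"]
    by (cases "k = l") (simp del: count_list.simps, presburger, simp)
qed simp

text \<open>A refill has total value 0, so the value of the output is exactly what leaves the
  queues.\<close>

lemma pending_pop:
  assumes "finite L" "l \<in> L" "val l 1 + val l 2 + val l 3 = 0"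
  shows "val l (front l g) + pending val L (pop l g) = pending val L g"
proof -
  have "sum_list (map (val l) (refill (g l))) = sum_list (map (val l) (g l))"
    using assms(3) by (simp add: refill_def)
  moreover have "(\<Sum>k\<in>L - {l}. sum_list (map (val k) (pop l g k)))
      = (\<Sum>k\<in>L - {l}. sum_list (map (val k) (g k)))"
    by (intro sum.cong) (auto simp: pop_def)
  ultimately show ?thesis
    by (simp add: pending_def sum.remove[OF assms(1,2)] refill_cases)
qed

lemma sum_outputs:
  assumes "finite L" "\<And>l. l \<in> L \<Longrightarrow> val l 1 + val l 2 + val l 3 = 0"
  shows "set w \<subseteq> L \<Longrightarrow>
    sum_list (map2 val w (outputs pop front g w)) = pending val L g - pending val L (fold pop w g)"
proof (induction w arbitrary: g)
  case (Cons l w)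
  then show ?case using pending_pop[OF assms(1), of l val g] assms(2)[of l] by simp
qed simp

lemma sum_outputs_count:
  assumes "finite L" "\<And>l. l \<in> L \<Longrightarrow> val l 1 + val l 2 + val l 3 = 0"
    and g: "g \<in> queues L" and w: "set w \<subseteq> L"
    and count: "\<And>l. l \<in> L \<Longrightarrow> length (g l) = count_list w l mod 3"
  shows "sum_list (map2 val w (outputs pop front g w)) = pending val L g"
proof -
  \<comment> \<open>The final length is a multiple of 3 and at most 2.\<close>
  have "fold pop w g l = []" if l: "l \<in> L" for l
  proof -
    have "(length (fold pop w g l) + count_list w l) mod 3 = count_list w l mod 3"
      using length_fold_pop[of w g l] count[OF l] by simp
    moreover have "(x + c) mod 3 = c mod 3 \<Longrightarrow> x mod 3 = 0" for x c :: nat by presburger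
    ultimately have "length (fold pop w g l) mod 3 = 0" by blast
    moreover have "length (fold pop w g l) \<le> 2"
      using queue_bounds(2)[OF fold_pop_in_queues[OF g w] l] .
    ultimately show ?thesis by (cases "fold pop w g l") auto
  qed
  then have "pending val L (fold pop w g) = 0" by (simp add: pending_def)
  then show ?thesis using sum_outputs[of L val w g] assms(1,2) w by simp
qed

section \<open>Item matrices as letters, and the resulting program\<close>

definition entry :: "nat \<Rightarrow> nat \<Rightarrow> tree \<Rightarrow> tree" where
  "entry i j d = left ((right ^^ (j - 1)) (left ((right ^^ (i - 1)) d)))"

definition item_gain :: "nat \<Rightarrow> nat \<Rightarrow> tree \<Rightarrow> nat \<Rightarrow> int" where
  "item_gain i j d r = gain i j r (entry i j d \<noteq> entry i i d)"

text \<open>One copy for each agent contributes 1 at \<open>i\<close>, -1 at \<open>j\<close> and 0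
  at the third agent, or three zeros.\<close>

lemma item_gain_sum:
  assumes "i \<in> {1..3}" "j \<in> {1..3}" "i \<noteq> j"
  shows "item_gain i j d 1 + item_gain i j d 2 + item_gain i j d 3 = 0"
proof -
  have "gain i j 1 b + gain i j 2 b + gain i j 3 b = 0" for b
  proof (cases b)
    case True
    have "i = 1 \<or> i = 2 \<or> i = 3" "j = 1 \<or> j = 2 \<or> j = 3" using assms by auto
    then show ?thesis using True assms(3) by (elim disjE) (simp_all add: gain_def)
  qed (simp add: gain_def)
  then show ?thesis by (simp add: item_gain_def)
qed

lemma kernel_queues_exist:
  assumes "finite L" and q: "\<And>l. l \<in> L \<Longrightarrow> q l < 3"
  shows "\<exists>g\<in>queues L. (\<forall>l\<in>L. length (g l) = q l) \<and>
    (\<forall>i\<in>{1..3}. \<forall>j\<in>{1..3}. i \<noteq> j \<longrightarrow> - 1 \<le> pending (item_gain i j) L g)"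
proof -
  \<comment> \<open>\<open>(l, k)\<close> is a leftover item of kind \<open>l\<close>; a balanced
    assignment of these copies, at most two per kind, fills the queues.\<close>
  define A where "A = Sigma L (\<lambda>l. {..<q l})"
  have "finite A" using assms(1) by (simp add: A_def)
  then obtain p where p: "\<forall>a. p a \<in> {1..3}"
    "\<forall>i\<in>{1..3}. \<forall>j\<in>{1..3}. i \<noteq> j \<longrightarrow>
      - 1 \<le> (\<Sum>a\<in>A. gain i j (p a) (entry i j (fst a) \<noteq> entry i i (fst a)))"
    using balanced_assignment[of A "\<lambda>i j a. entry i j (fst a) \<noteq> entry i i (fst a)"] by blast
  define g where "g = (\<lambda>l\<in>L. map (\<lambda>k. p (l, k)) [0..<q l])"
  have "g \<in> queues L"
    unfolding queues_def g_def
  proof (rule restrict_PiE_iff[THEN iffD2], rule ballI)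
    fix l assume "l \<in> L"
    then show "map (\<lambda>k. p (l, k)) [0..<q l] \<in> {rs. set rs \<subseteq> {1..3} \<and> length rs \<le> 2}"
      using p(1) q[of l] by (auto simp del: atLeastAtMost_iff)
  qed
  moreover have pending_g: "pending (item_gain i j) L g
      = (\<Sum>a\<in>A. gain i j (p a) (entry i j (fst a) \<noteq> entry i i (fst a)))" for i j
  proof -
    have "pending (item_gain i j) L g = (\<Sum>l\<in>L. \<Sum>k<q l. item_gain i j l (p (l, k)))"
      unfolding pending_def g_def
      by (intro sum.cong) (auto simp: o_def interv_sum_list_conv_sum_set_nat atLeast0LessThan)
    also have "\<dots> = (\<Sum>(l, k)\<in>A. item_gain i j l (p (l, k)))"
      unfolding A_def using assms(1) by (intro sum.Sigma) auto
    also have "\<dots> = (\<Sum>a\<in>A. gain i j (p a) (entry i j (fst a) \<noteq> entry i i (fst a)))"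
      by (simp add: item_gain_def case_prod_unfold)
    finally show ?thesis .
  qed
  moreover have "\<forall>l\<in>L. length (g l) = q l" by (simp add: g_def)
  moreover have "\<forall>i\<in>{1..3}. \<forall>j\<in>{1..3}. i \<noteq> j \<longrightarrow> - 1 \<le> pending (item_gain i j) L g"
    using p(2) by (simp only: pending_g)
  ultimately show ?thesis by blast
qed

definition item_code :: "'a valuation \<Rightarrow> 'a \<Rightarrow> tree" where
  "item_code V a = enc_list (map (\<lambda>i. enc_list (map (\<lambda>j. enc_bit (V i j a)) [1..<Suc 3])) [1..<Suc 3])"

text \<open>The alphabet has 512 letters: items are counted by their full 0/1 matrix, a finer
  division than the 64 types.\<close>

definition item_codes :: "tree set" where
  "item_codes = enc_list ` {rows. set rows \<subseteq>
     enc_list ` {bs. set bs \<subseteq> {Leaf, Node Leaf Leaf} \<and> length bs = 3} \<and> length rows = 3}"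

lemma finite_item_codes: "finite item_codes"
  unfolding item_codes_def by (intro finite_imageI finite_lists_length_eq) auto

lemma item_code_in: "item_code V a \<in> item_codes"
proof -
  have "enc_list (map (\<lambda>j. enc_bit (V i j a)) [1..<Suc 3])
      \<in> enc_list ` {bs. set bs \<subseteq> {Leaf, Node Leaf Leaf} \<and> length bs = 3}" for i
    by (intro imageI) (simp add: image_subset_iff enc_bit_def)
  then show ?thesis
    unfolding item_codes_def item_code_def
    by (intro imageI) (simp add: image_subset_iff del: upt_Suc)
qed

lemma entry_item_code:
  assumes "i \<in> {1..3}" "j \<in> {1..3}"
  shows "entry i j (item_code V a) = enc_bit (V i j a)"
proof -
  have upt: "[1..<Suc 3] = [1, 2, 3]" by (simp add: upt_rec)
  have "i = 1 \<or> i = 2 \<or> i = 3" "j = 1 \<or> j = 2 \<or> j = 3" using assms by auto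
  then show ?thesis
    unfolding entry_def item_code_def upt by (elim disjE) (simp_all add: numeral_eq_Suc)
qed

text \<open>\<open>enc_bit\<close> identifies all nonzero values; for binary values, comparing codes
  is comparing values.\<close>

lemma item_gain_code:
  assumes "binary_valuations 3 A V" "a \<in> A" "i \<in> {1..3}" "j \<in> {1..3}"
  shows "item_gain i j (item_code V a) r = gain i j r (V i j a \<noteq> V i i a)"
proof -
  have "V i j a \<in> {0, 1}" "V i i a \<in> {0, 1}"
    using assms by (auto simp: binary_valuations_def)
  then have "enc_bit (V i j a) = enc_bit (V i i a) \<longleftrightarrow> V i j a = V i i a"
    by (auto simp: enc_bit_def)
  then show ?thesis using assms by (simp add: item_gain_def entry_item_code)
qed

lemma length_le_tree_size: "length w \<le> tree_size (enc_list w)"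
  by (induction w) auto

lemma EFX_computable:
  "\<exists>(c :: com) (q :: nat poly). \<forall>(m :: nat) (V :: nat valuation).
      binary_valuations 3 {1..m} V \<and> no_weak_chores 3 {1..m} V \<longrightarrow>
      (\<exists>\<pi> t. EFX 3 {1..m} V \<pi>
         \<and> computes_in c (enc_instance 3 m V) (enc_allocation 3 m \<pi>) t
         \<and> t \<le> poly q (tree_size (enc_instance 3 m V)))"
proof -
  define Q where "Q = item_codes \<rightarrow>\<^sub>E {..<3::nat}"
  define tally where "tally l q = q(l := (q l + 1) mod 3)" for l and q :: "tree \<Rightarrow> nat"
  define q0 where "q0 = (\<lambda>l\<in>item_codes. 0 :: nat)"
  define good where "good q g \<longleftrightarrow> g \<in> queues item_codes \<and> (\<forall>l\<in>item_codes. length (g l) = q l) \<and>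
    (\<forall>i\<in>{1..3}. \<forall>j\<in>{1..3}. i \<noteq> j \<longrightarrow> - 1 \<le> pending (item_gain i j) item_codes g)"
    for q :: "tree \<Rightarrow> nat" and g
  \<comment> \<open>The choice is made once for each of the finitely many residue vectors in
    \<open>Q\<close> and stored in the program as a table.\<close>
  define h where "h q = (SOME g. good q g)" for q
  have h: "good q (h q)" if "q \<in> Q" for q
  proof -
    have "\<exists>g. good q g"
      using kernel_queues_exist[OF finite_item_codes, of q] that
      by (auto simp: good_def Q_def PiE_iff)
    then show ?thesis unfolding h_def by (rule someI_ex)
  qed
  have tally_in: "tally l q \<in> Q" if "q \<in> Q" "l \<in> item_codes" for q l
    using PiE_fun_upd[of "(q l + 1) mod 3" "\<lambda>_. {..<3}" l q item_codes] that
    by (simp add: tally_def Q_def insert_absorb)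
  have q0: "q0 \<in> Q" by (auto simp: q0_def Q_def)
  have "\<exists>c K. \<forall>w. set w \<subseteq> item_codes \<longrightarrow> (\<exists>t\<le>K * (length w + 1). computes_in c (enc_list w)
    (enc_list (rev (outputs pop (\<lambda>l g. enc_nat (front l g)) (h (fold tally w q0)) (rev w)))) t)"
    using h by (intro two_pass_computable[where Q = Q and P = "queues item_codes"])
      (auto simp: Q_def[symmetric] finite_item_codes finite_queues q0 tally_in pop_in_queues good_def
        intro: finite_PiE[of item_codes "\<lambda>_. {..<3::nat}", folded Q_def])
  then obtain c K where c: "\<And>w. set w \<subseteq> item_codes \<Longrightarrow> \<exists>t\<le>K * (length w + 1). computes_in c (enc_list w)
    (enc_list (rev (outputs pop (\<lambda>l g. enc_nat (front l g)) (h (fold tally w q0)) (rev w)))) t"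
    by blast
  have "\<exists>\<pi> t. EFX 3 {1..m} V \<pi> \<and> computes_in c (enc_instance 3 m V) (enc_allocation 3 m \<pi>) t
         \<and> t \<le> poly [:K, K:] (tree_size (enc_instance 3 m V))"
    if bin: "binary_valuations 3 {1..m} V" and nwc: "no_weak_chores 3 {1..m} V"
    for m and V :: "nat valuation"
  proof -
    define w where "w = map (item_code V) [1..<Suc m]"
    have w: "set w \<subseteq> item_codes" by (auto simp: w_def item_code_in)
    have inst: "enc_instance 3 m V = enc_list w"
      by (simp only: enc_instance_def w_def item_code_def[abs_def])
    define g where "g = h (fold tally w q0)"
    have fold_in: "set v \<subseteq> item_codes \<Longrightarrow> q \<in> Q \<Longrightarrow> fold tally v q \<in> Q" for v q
      by (induction v arbitrary: q) (auto simp: tally_in)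
    have g: "good (fold tally w q0) g"
      unfolding g_def using h fold_in[OF w q0] by blast
    \<comment> \<open>Reduced modulo 3 on both sides because an arbitrary \<open>q l\<close> may
      exceed 2.\<close>
    have tally_mod: "fold tally v q l mod 3 = (q l + count_list v l) mod 3" for v q l
      by (induction v arbitrary: q) (auto simp: tally_def mod_simps)
    have count: "length (g l) = count_list (rev w) l mod 3" if l: "l \<in> item_codes" for l
    proof -
      have "fold tally w q0 l \<in> {..<3}"
        using fold_in[OF w q0] l unfolding Q_def by (rule PiE_mem)
      then have "fold tally w q0 l = (q0 l + count_list w l) mod 3"
        using tally_mod[of w q0 l] by simp
      moreover have "length (g l) = fold tally w q0 l" using g l by (simp add: good_def)
      ultimately show ?thesis using l by (simp add: q0_def)
    qed
    \<comment> \<open>The second pass meets the items in reverse; the outer \<open>rev\<close>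
      restores their order.\<close>
    define rs where "rs = rev (outputs pop front g (rev w))"
    have len: "length rs = m" "length w = m" by (simp_all add: rs_def w_def)
    define p where "p a = rs ! (a - 1)" for a
    have rs_eq: "rs = map p [1..<Suc m]"
      using len by (intro nth_equalityI) (simp_all add: p_def del: upt_Suc)
    have p: "p a \<in> {1..3}" if "a \<in> {1..m}" for a
    proof -
      have "p a \<in> set rs" unfolding rs_eq set_map using that by (intro imageI) auto
      moreover have "set rs \<subseteq> {1..3}"
        using set_outputs[of g item_codes "rev w"] g w by (simp add: rs_def good_def)
      ultimately show ?thesis by blast
    qed
    have "- 1 \<le> (\<Sum>a\<in>{1..m}. gain i j (p a) (V i j a \<noteq> V i i a))"
      if ij: "i \<in> {1..3}" "j \<in> {1..3}" "i \<noteq> j" for i j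
    proof -
      have "(\<Sum>a\<in>{1..m}. gain i j (p a) (V i j a \<noteq> V i i a))
          = (\<Sum>a\<in>{1..m}. item_gain i j (item_code V a) (p a))"
        using item_gain_code[OF bin] ij by (intro sum.cong) auto
      also have "\<dots> = sum_list (map2 (item_gain i j) w rs)"
        unfolding rs_eq w_def
        by (simp add: map2_map_map interv_sum_list_conv_sum_set_nat atLeastLessThanSuc_atLeastAtMost
            del: upt_Suc)
      \<comment> \<open>Reversing both lists keeps the pairs and gives the order of the second
        pass.\<close>
      also have "\<dots> = sum_list (map2 (item_gain i j) (rev w) (rev rs))"
        by (subst zip_rev) (use len in \<open>simp_all add: rev_map[symmetric]\<close>)
      also have "\<dots> = pending (item_gain i j) item_codes g"
        unfolding rs_def rev_rev_ident
        using g w count item_gain_sum[OF ij]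
        by (intro sum_outputs_count finite_item_codes) (auto simp: good_def)
      also have "\<dots> \<ge> - 1" using g ij by (auto simp: good_def)
      finally show ?thesis .
    qed
    then have EFX: "EFX 3 {1..m} V (alloc_of {1..m} p)"
      using bin nwc p by (intro EFX_alloc_of) auto
    have "receiver 3 (alloc_of {1..m} p) a = p a" if "a \<in> {1..m}" for a
      using EFX p[OF that] that by (intro receiver_eq) (auto simp: EFX_def is_allocation_def alloc_of_def)
    then have "enc_allocation 3 m (alloc_of {1..m} p) = enc_list (map enc_nat rs)"
      unfolding enc_allocation_def rs_eq by (auto intro!: arg_cong[of _ _ enc_list])
    also have "map enc_nat rs = rev (outputs pop (\<lambda>l g. enc_nat (front l g)) g (rev w))"
      by (simp add: rs_def rev_map[symmetric] map_outputs)
    finally obtain t where t: "t \<le> K * (length w + 1)"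
      "computes_in c (enc_instance 3 m V) (enc_allocation 3 m (alloc_of {1..m} p)) t"
      using c[OF w] by (auto simp: g_def inst)
    \<comment> \<open>Every item adds at least one node to the input, so time linear in the number
      of items is linear in the input size.\<close>
    have "t \<le> K * (tree_size (enc_list w) + 1)"
      using t(1) length_le_tree_size[of w] by (meson add_le_mono1 le_trans mult_le_mono2)
    then have "t \<le> poly [:K, K:] (tree_size (enc_instance 3 m V))"
      by (simp add: inst algebra_simps)
    then show ?thesis using EFX t(2) by blast
  qed
  then show ?thesis by blast
qed

theorem theorem4p3:
  "(\<forall>(A :: 'a set) (V :: 'a valuation).
      finite A \<and> binary_valuations 3 A V \<and> no_weak_chores 3 A V \<longrightarrow> (\<exists>\<pi>. EFX 3 A V \<pi>))
   \<and>
   (\<exists>(c :: com) (q :: nat poly). \<forall>(m :: nat) (V :: nat valuation).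
      binary_valuations 3 {1..m} V \<and> no_weak_chores 3 {1..m} V \<longrightarrow>
      (\<exists>\<pi> t. EFX 3 {1..m} V \<pi>
         \<and> computes_in c (enc_instance 3 m V) (enc_allocation 3 m \<pi>) t
         \<and> t \<le> poly q (tree_size (enc_instance 3 m V))))"
  using EFX_exists EFX_computable by blast

end
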